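(* Let $(x,p,p^0,u)$ be an extremal, with final time $T>0$, of the minimum-time problem $\mathbf{OCP}$ of reaching $\partial\mathcal{S}$ from $\bar{x}_0\in\mathcal{S}$; that is, $p:[0,T]\to\mathbb{R}^n$ is absolutely continuous, $p^0\in\{-1,0\}$, $(p,p^0)\neq 0$, $x_0=\bar x_0$, and $$\dot{x}_t=f(x_t)+g(x_t)u_t,\qquad \dot{p}_t=-(\nabla f(x_t)+\nabla g(x_t)u_t)^\top p_t,\qquad u_t\in\mathop{\arg\max}_{v\in\mathcal{U}}\,p_t^\top g(x_t)v,$$ $$x_T\in\partial\mathcal{S},\qquad p_T\perp T_{x_T}\partial\mathcal{S},\qquad p_T^\top(f(x_T)+g(x_T)u_T)=-p^0.$$ Assume that: (A1) the tangent space $T_{x_T}\partial\mathcal{S}$ is of dimension $n-1$; (A2) $x_t\in\mathcal{S}$ for all $t\in[0,T]$; (A3) for some $\epsilon>0$, the control $u$ can be smoothly extended over $(T,T+\epsilon)$ such that the corresponding state trajectory satisfies $x_t\in\mathcal{S}$ for all $t\in[0,T+\epsilon)$. Then $p^0=0$.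
   Context: Dynamics: $\dot{x}_t=f(x_t)+g(x_t)u_t$ with state $x_t\in\mathbb{R}^n$ and control $u_t\in\mathcal{U}\subset\mathbb{R}^m$ ($\mathcal{U}$ is the admissible control set), where $f:\mathbb{R}^n\to\mathbb{R}^n$ and $g:\mathbb{R}^n\to\mathbb{R}^{n\times m}$ are Lipschitz and differentiable with Lipschitz Jacobians. $\nabla f(x)$ is the Jacobian of $f$, and $\nabla g(x)u$ denotes the Jacobian at $x$ of $y\mapsto g(y)u$ with $u$ fixed. The safe set is $\mathcal{S}=\{x\in\mathbb{R}^n:h(x)\geq 0\}$ with $h:\mathbb{R}^n\to\mathbb{R}$ continuously differentiable; $\partial\mathcal{S}$ is its boundary and $T_{x_T}\partial\mathcal{S}$ is the tangent space of $\partial\mathcal{S}$ at $x_T$. $\mathbf{OCP}$ is the free-final-time optimal control problem: given a fixed $\bar{x}_0$ inside $\mathcal{S}$, minimize $T$ over pairs $(u,T)$ subject to $\dot{x}_t=f(x_t)+g(x_t)u_t$ for $t\in[0,T]$, $x_0=\bar{x}_0$, and $x_T\in\partial\mathcal{S}$. An extremal is a tuple $(x,p,p^0,u)$ satisfying the conditions displayed in the claim (the necessary optimality conditions of the Pontryagin Maximum Principle); it is called normal if $p^0=-1$ and abnormal if $p^0=0$. Convention for (A3): a smooth extension of $u$ is a control $\tilde u:[0,T+\epsilon)\to\mathcal{U}$ with $\tilde u=u$ on $[0,T]$ that continues $u$ smoothly past time $T$ (in particular $\tilde u$ is smooth on $[T,T+\epsilon)$ with $\tilde u_T=u_T$, so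 there is no jump in the control at $T$), and $x$ on $[0,T+\epsilon)$ is the trajectory driven by $\tilde u$. *)

theory Defs
  imports "HOL-Analysis.Analysis"
begin

section \<open>Regularity of maps\<close>

definition C1_map_on :: "('a::real_normed_vector \<Rightarrow> 'b::real_normed_vector) \<Rightarrow> 'a set \<Rightarrow> bool"
  where "C1_map_on F W \<longleftrightarrow>
    (\<exists>F' :: 'a \<Rightarrow> 'a \<Rightarrow>\<^sub>L 'b.
       (\<forall>y\<in>W. (F has_derivative blinfun_apply (F' y)) (at y)) \<and> continuous_on W F')"

definition lipschitz_with_lipschitz_jacobian ::
    "('a::real_normed_vector \<Rightarrow> 'b::real_normed_vector) \<Rightarrow> bool"
  where "lipschitz_with_lipschitz_jacobian F \<longleftrightarrow>
    (\<exists>L. L-lipschitz_on UNIV F) \<and>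
    (\<exists>F' :: 'a \<Rightarrow> 'a \<Rightarrow>\<^sub>L 'b.
       (\<forall>y. (F has_derivative blinfun_apply (F' y)) (at y)) \<and> (\<exists>L. L-lipschitz_on UNIV F'))"

text \<open>
  \<open>C\<^sup>\<infinity>\<close> on an interval, with one-sided derivatives at the endpoints that belong to it:
  \<open>D k\<close> is the \<open>k\<close>-th derivative.
\<close>

definition smooth_on_interval :: "(real \<Rightarrow> 'a::real_normed_vector) \<Rightarrow> real set \<Rightarrow> bool"
  where "smooth_on_interval w I \<longleftrightarrow>
    (\<exists>D :: nat \<Rightarrow> real \<Rightarrow> 'a.
       (\<forall>t\<in>I. D 0 t = w t) \<and>
       (\<forall>k. \<forall>t\<in>I. (D k has_vector_derivative D (Suc k) t) (at t within I)))"

text \<open>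
  Absolute continuity of a curve on an interval. The sets \<open>d\<close> with \<open>d division_of \<Union>d\<close> are the finite
  families of non-overlapping compact intervals; \<open>Inf k\<close> and \<open>Sup k\<close> are the endpoints of \<open>k\<close>.
\<close>

definition abs_continuous_on :: "real set \<Rightarrow> (real \<Rightarrow> 'a::real_normed_vector) \<Rightarrow> bool"
  where "abs_continuous_on I F \<longleftrightarrow>
    (\<forall>e>0. \<exists>\<delta>>0. \<forall>d. d division_of \<Union>d \<and> \<Union>d \<subseteq> I \<and> (\<Sum>k\<in>d. Sup k - Inf k) < \<delta>
       \<longrightarrow> (\<Sum>k\<in>d. norm (F (Sup k) - F (Inf k))) < e)"


section \<open>Tangent spaces\<close>

text \<open>
  \<open>M\<close> is, near its point \<open>x\<close>, an embedded \<open>C\<^sup>1\<close> submanifold: a \<open>C\<^sup>1\<close> diffeomorphism \<open>\<Phi>\<close> between open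
  sets, with inverse \<open>\<Psi>\<close>, flattens \<open>M\<close> to a linear subspace \<open>L\<close>, whose dimension is left free.
\<close>

definition C1_submanifold_at :: "'a::euclidean_space set \<Rightarrow> 'a \<Rightarrow> bool"
  where "C1_submanifold_at M x \<longleftrightarrow> x \<in> M \<and>
    (\<exists>W V (\<Phi> :: 'a \<Rightarrow> 'a) (\<Psi> :: 'a \<Rightarrow> 'a) L.
       open W \<and> open V \<and> x \<in> W \<and> homeomorphism W V \<Phi> \<Psi> \<and>
       C1_map_on \<Phi> W \<and> C1_map_on \<Psi> V \<and> subspace L \<and> \<Phi> ` (M \<inter> W) = L \<inter> V)"

text \<open>
  Velocities at \<open>x\<close> of the \<open>C\<^sup>1\<close> curves in \<open>M\<close> through \<open>x\<close>. This is the tangent space of \<open>M\<close> at \<open>x\<close> when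
  \<open>M\<close> is a \<open>C\<^sup>1\<close> submanifold near \<open>x\<close>; for other sets it need not be a linear space.
\<close>

definition tangent_space :: "'a::euclidean_space set \<Rightarrow> 'a \<Rightarrow> 'a set"
  where "tangent_space M x =
    {v. \<exists>\<delta>>0. \<exists>\<gamma> :: real \<Rightarrow> 'a.
          \<gamma> C1_differentiable_on {-\<delta><..<\<delta>} \<and> \<gamma> ` {-\<delta><..<\<delta>} \<subseteq> M \<and> \<gamma> 0 = x \<and>
          (\<gamma> has_vector_derivative v) (at 0)}"


section \<open>Safe set, trajectories and extremals\<close>

definition safe_set :: "('a \<Rightarrow> real) \<Rightarrow> 'a set"
  where "safe_set h = {x. h x \<ge> 0}"

text \<open>
  A control need not be continuous, so trajectories are Caratheodory solutions: locally absolutely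
  continuous curves that satisfy the differential equation almost everywhere.
\<close>

definition trajectory ::
    "(real^'n \<Rightarrow> real^'n) \<Rightarrow> (real^'n \<Rightarrow> real^'m^'n) \<Rightarrow> (real \<Rightarrow> real^'m) \<Rightarrow> real set
      \<Rightarrow> (real \<Rightarrow> real^'n) \<Rightarrow> bool"
  where "trajectory f g u I x \<longleftrightarrow>
    (\<forall>a b. {a..b} \<subseteq> I \<longrightarrow> abs_continuous_on {a..b} x) \<and>
    (AE t in lebesgue_on I. (x has_vector_derivative f (x t) + g (x t) *v u t) (at t within I))"

text \<open>
  Extremals, with final time \<open>T\<close>, of the problem of reaching the boundary of \<open>S\<close> from \<open>x0\<close> in minimum
  time. The adjoint equation and the maximality condition hold almost everywhere, as for measurable
  controls; the condition at the final time involves the value \<open>u T\<close>.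
\<close>

definition extremal ::
    "(real^'n \<Rightarrow> real^'n) \<Rightarrow> (real^'n \<Rightarrow> real^'m^'n) \<Rightarrow> (real^'m) set \<Rightarrow> (real^'n) set \<Rightarrow> real^'n
      \<Rightarrow> real \<Rightarrow> (real \<Rightarrow> real^'n) \<Rightarrow> (real \<Rightarrow> real^'n) \<Rightarrow> real \<Rightarrow> (real \<Rightarrow> real^'m) \<Rightarrow> bool"
  where "extremal f g U S x0 T x p p0 u \<longleftrightarrow>
    u \<in> {0..T} \<rightarrow> U \<and>
    trajectory f g u {0..T} x \<and> x 0 = x0 \<and>
    abs_continuous_on {0..T} p \<and>
    p0 \<in> {-1, 0} \<and>
    (\<exists>t\<in>{0..T}. (p t, p0) \<noteq> (0, 0)) \<and>
    (AE t in lebesgue_on {0..T}.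
       (p has_vector_derivative
          - (transpose (jacobian f (at (x t)) + jacobian (\<lambda>y. g y *v u t) (at (x t))) *v p t))
       (at t within {0..T})) \<and>
    (AE t in lebesgue_on {0..T}. is_arg_max (\<lambda>v. p t \<bullet> (g (x t) *v v)) (\<lambda>v. v \<in> U) (u t)) \<and>
    x T \<in> frontier S \<and>
    (\<forall>v \<in> tangent_space (frontier S) (x T). orthogonal (p T) v) \<and>
    p T \<bullet> (f (x T) + g (x T) *v u T) = - p0"

text \<open>
  \<open>u'\<close> continues the control \<open>u\<close> smoothly past time \<open>T\<close>, up to time \<open>T + \<epsilon>\<close>. Continuity of \<open>u'\<close> at \<open>T\<close>
  is two-sided: it excludes a jump of the control at \<open>T\<close>, including one between the values of \<open>u\<close> just
  before \<open>T\<close> and \<open>u T\<close>, which smoothness on the right of \<open>T\<close> alone would allow.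
\<close>

definition smooth_control_extension ::
    "(real^'m) set \<Rightarrow> real \<Rightarrow> real \<Rightarrow> (real \<Rightarrow> real^'m) \<Rightarrow> (real \<Rightarrow> real^'m) \<Rightarrow> bool"
  where "smooth_control_extension U T \<epsilon> u u' \<longleftrightarrow>
    u' \<in> {0..<T + \<epsilon>} \<rightarrow> U \<and> (\<forall>t\<in>{0..T}. u' t = u t) \<and>
    smooth_on_interval u' {T..<T + \<epsilon>} \<and> isCont u' T"

end

theory Submission
  imports Defs
begin

text \<open>
  If \<open>p0 = -1\<close>, the final condition reads \<open>p T \<bullet> v = 1\<close> for the velocity \<open>v = f (x T) + g (x T) *v u T\<close>, so
  \<open>v\<close> is not tangent to the frontier of the safe set. Because the extended control is continuous at \<open>T\<close>,
  the extended Caratheodory trajectory is differentiable at \<open>T\<close> with derivative \<open>v\<close>. It therefore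
  crosses the frontier, a \<open>C\<^sup>1\<close> hypersurface near \<open>x T\<close>, from one side to the other; as it
  stays in the safe set, both sides belong to the safe set near \<open>x T\<close>, and \<open>x T\<close> would be an
  interior point.
\<close>

section \<open>A mean value estimate for absolutely continuous curves\<close>

text \<open>Comparing both endpoints with \<open>F t\<close> gives errors \<open>e * (t - y)\<close>
  and \<open>e * (z - t)\<close>, which add up to \<open>e * (z - y)\<close> because
  \<open>t\<close> lies between them. The constant \<open>c\<close> pays for replacing
  \<open>D\<close> by \<open>v\<close>.\<close>

lemma has_vector_derivative_straddle:
  fixes F :: "real \<Rightarrow> 'a::real_normed_vector"
  assumes F: "(F has_vector_derivative D) (at t within I)" and D: "norm (D - v) \<le> c" and "e > 0"
  obtains r where "r > 0"
    "\<And>y z. \<lbrakk>y \<in> I; z \<in> I; y \<le> t; t \<le> z; {y..z} \<subseteq> ball t r\<rbrakk>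
       \<Longrightarrow> norm (F z - F y - (z - y) *\<^sub>R v) \<le> (c + e) * (z - y)"
proof -
  obtain r where "r > 0" and r: "\<And>y. \<lbrakk>y \<in> I; norm (y - t) < r\<rbrakk>
      \<Longrightarrow> norm (F y - F t - (y - t) *\<^sub>R D) \<le> e * norm (y - t)"
    using F \<open>e > 0\<close> unfolding has_vector_derivative_def has_derivative_within_alt by meson
  have "norm (F z - F y - (z - y) *\<^sub>R v) \<le> (c + e) * (z - y)"
    if yz: "y \<in> I" "z \<in> I" "y \<le> t" "t \<le> z" "{y..z} \<subseteq> ball t r" for y z
  proof -
    have "y \<in> ball t r" "z \<in> ball t r"
      using subsetD[OF yz(5)] yz(3,4) by auto
    then have "norm (F y - F t - (y - t) *\<^sub>R D) \<le> e * (t - y)"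
      "norm (F z - F t - (z - t) *\<^sub>R D) \<le> e * (z - t)"
      using r[of y] r[of z] yz by (auto simp: dist_real_def)
    moreover have "norm ((z - y) *\<^sub>R (D - v)) \<le> c * (z - y)"
      using D yz by (simp add: mult.commute[of c] mult_left_mono)
    moreover have "F z - F y - (z - y) *\<^sub>R v =
        (F z - F t - (z - t) *\<^sub>R D) - (F y - F t - (y - t) *\<^sub>R D) + (z - y) *\<^sub>R (D - v)"
      by (simp add: algebra_simps)
    ultimately show ?thesis
      using norm_triangle_ineq[of "(F z - F t - (z - t) *\<^sub>R D) - (F y - F t - (y - t) *\<^sub>R D)"
          "(z - y) *\<^sub>R (D - v)"]
        norm_triangle_ineq4[of "F z - F t - (z - t) *\<^sub>R D" "F y - F t - (y - t) *\<^sub>R D"]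
      by (simp add: algebra_simps)
  qed
  with \<open>r > 0\<close> that show ?thesis by blast
qed

text \<open>Lengths of non-overlapping intervals add up to the measure of their union. Removing the
  null set \<open>N\<close> leaves that measure unchanged, so it is bounded by the measure of
  \<open>G - N\<close>, the form in which outer regularity provides smallness.\<close>

lemma sum_length_division_less:
  fixes d :: "real set set"
  assumes d: "d division_of \<Union>d" and sub: "\<Union>d \<subseteq> G" and N: "negligible N"
    and G: "G - N \<in> lmeasurable" "emeasure lebesgue (G - N) < ennreal \<delta>" and "\<delta> > 0"
  shows "(\<Sum>k\<in>d. Sup k - Inf k) < \<delta>"
proof -
  have "Sup k - Inf k = measure lebesgue k" if k: "k \<in> d" for k
  proof -
    obtain y z where "k = {y..z}" "k \<noteq> {}"
      using division_ofD(3,4)[OF d k] by (metis box_real(2))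
    then show ?thesis by simp
  qed
  then have "(\<Sum>k\<in>d. Sup k - Inf k) = measure lebesgue (\<Union>d)"
    using content_division[OF d] by simp
  also have "\<dots> = measure lebesgue (\<Union>d - N)"
    using lmeasurable_division[OF d] N
    by (simp add: measure_Diff_null_set negligible_iff_null_sets fmeasurableD)
  also have "\<dots> \<le> measure lebesgue (G - N)"
    using sub lmeasurable_division[OF d] N G(1)
    by (intro measure_mono_fmeasurable) (auto simp: negligible_imp_sets fmeasurableD)
  also have "\<dots> < \<delta>"
    using G \<open>\<delta> > 0\<close> by (simp add: emeasure_eq_measure2 ennreal_less_iff)
  finally show ?thesis .
qed

text \<open>
  Cousin's lemma splits \<open>[a,b]\<close> into short intervals tagged by points of differentiability, where the
  straddle estimate applies, and intervals lying in an open set of small measure around \<open>N\<close>, where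
  absolute continuity applies.
\<close>

proposition abs_continuous_mean_value:
  fixes F :: "real \<Rightarrow> 'a::real_normed_vector"
  assumes "a \<le> b" "c \<ge> 0" and F: "abs_continuous_on {a..b} F" and N: "negligible N"
    and der: "\<And>t. t \<in> {a..b} - N \<Longrightarrow>
      \<exists>D. (F has_vector_derivative D) (at t within {a..b}) \<and> norm (D - v) \<le> c"
  shows "norm (F b - F a - (b - a) *\<^sub>R v) \<le> c * (b - a)"
proof (rule field_le_epsilon)
  fix e :: real assume "e > 0"
  \<comment> \<open>Three errors are to be absorbed: \<open>\<eta> * (b - a)\<close> from the
    straddle estimates, and \<open>\<eta>\<close> and \<open>\<eta> * norm v\<close> from the
    intervals tagged in \<open>N\<close>. The denominator makes them add up to
    \<open>e\<close>.\<close>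
  define \<eta> where "\<eta> = e / (b - a + 1 + norm v)"
  have pos: "b - a + 1 + norm v > 0"
    using \<open>a \<le> b\<close> norm_ge_zero[of v] by linarith
  have "\<eta> > 0"
    using pos \<open>e > 0\<close> by (simp add: \<eta>_def)
  have "\<eta> * (b - a + 1 + norm v) = e"
    using pos by (simp add: \<eta>_def)
  then have \<eta>: "\<eta> * (b - a) + \<eta> + \<eta> * norm v = e"
    by (simp add: algebra_simps)
  obtain \<delta>0 where "\<delta>0 > 0" and \<delta>0: "\<And>d. \<lbrakk>d division_of \<Union>d; \<Union>d \<subseteq> {a..b}; (\<Sum>k\<in>d. Sup k - Inf k) < \<delta>0\<rbrakk>
      \<Longrightarrow> (\<Sum>k\<in>d. norm (F (Sup k) - F (Inf k))) < \<eta>"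
    using F \<open>\<eta> > 0\<close> unfolding abs_continuous_on_def by meson
  \<comment> \<open>On the intervals tagged in \<open>N\<close>, \<open>\<delta>0\<close> controls
    the variation of \<open>F\<close>, and \<open>\<eta>\<close> controls the total length and hence
    the contribution of \<open>v\<close>.\<close>
  define \<delta> where "\<delta> = min \<delta>0 \<eta>"
  have "\<delta> > 0"
    using \<open>\<delta>0 > 0\<close> \<open>\<eta> > 0\<close> by (simp add: \<delta>_def)
  obtain G where G: "open G" "N \<subseteq> G" "G - N \<in> lmeasurable" "emeasure lebesgue (G - N) < ennreal \<delta>"
    using sets_lebesgue_outer_open[OF negligible_imp_sets[OF N] \<open>\<delta> > 0\<close>] by blast
  \<comment> \<open>These radii form the gauge. At a tag outside both \<open>N\<close> and
    \<open>{a..b}\<close> any radius will do.\<close>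
  have "\<exists>r>0. (t \<in> N \<longrightarrow> ball t r \<subseteq> G) \<and>
      (t \<in> {a..b} - N \<longrightarrow> (\<forall>y z. y \<in> {a..b} \<longrightarrow> z \<in> {a..b} \<longrightarrow> y \<le> t \<longrightarrow> t \<le> z \<longrightarrow> {y..z} \<subseteq> ball t r
         \<longrightarrow> norm (F z - F y - (z - y) *\<^sub>R v) \<le> (c + \<eta>) * (z - y)))" for t
  proof (cases "t \<in> N")
    case True
    then show ?thesis
      using G by (metis DiffD2 openE subsetD)
  next
    case False
    show ?thesis
    proof (cases "t \<in> {a..b}")
      case True
      with False der obtain D
        where "(F has_vector_derivative D) (at t within {a..b})" "norm (D - v) \<le> c"
        by blast
      then show ?thesis
        using has_vector_derivative_straddle[OF _ _ \<open>\<eta> > 0\<close>] False by metis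
    next
      case nin: False
      with False show ?thesis
        using zero_less_one by blast
    qed
  qed
  then obtain r where r: "\<And>t. r t > 0" "\<And>t. t \<in> N \<Longrightarrow> ball t (r t) \<subseteq> G"
    "\<And>t y z. \<lbrakk>t \<in> {a..b} - N; y \<in> {a..b}; z \<in> {a..b}; y \<le> t; t \<le> z; {y..z} \<subseteq> ball t (r t)\<rbrakk>
       \<Longrightarrow> norm (F z - F y - (z - y) *\<^sub>R v) \<le> (c + \<eta>) * (z - y)"
    by metis
  obtain q where q: "q tagged_division_of {a..b}" "(\<lambda>t. ball t (r t)) fine q"
    using r(1) by (metis fine_division_exists_real gauge_ball_dependent)
  have q_elem: "\<exists>y z. k = {y..z} \<and> y \<le> t \<and> t \<le> z \<and> y \<in> {a..b} \<and> z \<in> {a..b} \<and> {y..z} \<subseteq> ball t (r t)"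
    if tk: "(t, k) \<in> q" for t k
  proof -
    obtain y z where k: "k = {y..z}"
      using tagged_division_ofD(4)[OF q(1) tk] by (metis box_real(2))
    moreover have "t \<in> k" "k \<subseteq> {a..b}"
      using tagged_division_ofD(2,3)[OF q(1) tk] by auto
    moreover have "k \<subseteq> ball t (r t)"
      using q(2) tk by (auto simp: fine_def)
    ultimately show ?thesis
      by auto
  qed
  have "finite q"
    using q(1) by auto
  define B where "B = {(t, k) \<in> q. t \<in> N}"
  have "B \<subseteq> q"
    by (auto simp: B_def)
  define \<Delta> where "\<Delta> k = F (Sup k) - F (Inf k) - (Sup k - Inf k) *\<^sub>R v" for k
  have good: "norm (\<Delta> k) \<le> (c + \<eta>) * (Sup k - Inf k)" if tk: "(t, k) \<in> q - B" for t k
  proof -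
    have "t \<in> {a..b} - N"
      using tk tagged_division_ofD(2,3)[OF q(1), of t k] by (auto simp: B_def)
    with q_elem[of t k] r(3)[of t] tk show ?thesis
      by (auto simp: \<Delta>_def)
  qed
  have "(\<Sum>(t, k)\<in>q - B. norm (\<Delta> k)) \<le> (\<Sum>(t, k)\<in>q - B. (c + \<eta>) * (Sup k - Inf k))"
    using good by (intro sum_mono) auto
  \<comment> \<open>Putting the intervals of \<open>B\<close> back adds only nonnegative terms and
    lets the lengths telescope to \<open>b - a\<close>.\<close>
  also have "\<dots> \<le> (\<Sum>(t, k)\<in>q. (c + \<eta>) * (Sup k - Inf k))"
    using \<open>finite q\<close> q_elem \<open>c \<ge> 0\<close> \<open>\<eta> > 0\<close> by (intro sum_mono2) (auto, fastforce)
  also have "\<dots> = (c + \<eta>) * (b - a)"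
    using additive_tagged_division_1[OF \<open>a \<le> b\<close> q(1), of "\<lambda>t. t"]
    by (simp add: case_prod_unfold flip: sum_distrib_left)
  finally have good_sum: "(\<Sum>(t, k)\<in>q - B. norm (\<Delta> k)) \<le> (c + \<eta>) * (b - a)" .
  define d where "d = snd ` B"
  have Bpart: "B tagged_partial_division_of {a..b}"
    using q(1) \<open>B \<subseteq> q\<close> by (meson tagged_division_of_def tagged_partial_division_subset)
  have d: "d division_of \<Union>d"
    unfolding d_def by (rule partial_division_of_tagged_division[OF Bpart])
  have d_elem: "\<exists>y z. k = {y..z} \<and> y \<le> z" if "k \<in> d" for k
    using that q_elem \<open>B \<subseteq> q\<close> unfolding d_def by fastforce
  have "\<Union>d \<subseteq> G"
  proof -
    have "k \<subseteq> G" if "(t, k) \<in> B" for t k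
      using q_elem[of t k] r(2)[of t] that unfolding B_def by blast
    then show ?thesis
      by (fastforce simp: d_def)
  qed
  then have len: "(\<Sum>k\<in>d. Sup k - Inf k) < \<delta>"
    using sum_length_division_less[OF d _ N G(3,4) \<open>\<delta> > 0\<close>] by blast
  have "\<Union>d \<subseteq> {a..b}"
    using tagged_partial_division_ofD(3)[OF Bpart] by (fastforce simp: d_def)
  then have FB: "(\<Sum>k\<in>d. norm (F (Sup k) - F (Inf k))) < \<eta>"
    using \<delta>0[OF d] len by (simp add: \<delta>_def)
  \<comment> \<open>Distinct tags can share an interval only if it is degenerate, so the tags may be
    dropped once the summand vanishes on degenerate intervals. It does so on singletons; on the
    empty set, where \<open>Sup\<close> and \<open>Inf\<close> carry no information, it is set to
    0.\<close>
  have "(\<Sum>(t, k)\<in>B. norm (\<Delta> k)) = (\<Sum>(t, k)\<in>B. if k = {} then 0 else norm (\<Delta> k))"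
    using \<open>B \<subseteq> q\<close> q_elem by (intro sum.cong) fastforce+
  also have "\<dots> = (\<Sum>k\<in>d. if k = {} then 0 else norm (\<Delta> k))"
    unfolding d_def
    by (rule sum.over_tagged_division_lemma[OF tagged_partial_division_of_Union_self[OF Bpart]])
      (auto simp: \<Delta>_def)
  also have "\<dots> \<le> (\<Sum>k\<in>d. norm (F (Sup k) - F (Inf k)) + (Sup k - Inf k) * norm v)"
  proof (rule sum_mono)
    fix k assume "k \<in> d"
    with d_elem obtain y z where "k = {y..z}" "y \<le> z" by blast
    then show "(if k = {} then 0 else norm (\<Delta> k)) \<le> norm (F (Sup k) - F (Inf k)) + (Sup k - Inf k) * norm v"
      using norm_triangle_ineq4[of "F z - F y" "(z - y) *\<^sub>R v"] by (simp add: \<Delta>_def)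
  qed
  also have "\<dots> = (\<Sum>k\<in>d. norm (F (Sup k) - F (Inf k))) + (\<Sum>k\<in>d. Sup k - Inf k) * norm v"
    by (simp add: sum.distrib sum_distrib_right)
  also have "\<dots> \<le> \<eta> + \<eta> * norm v"
    using FB len by (intro add_mono mult_right_mono) (auto simp: \<delta>_def)
  finally have bad_sum: "(\<Sum>(t, k)\<in>B. norm (\<Delta> k)) \<le> \<eta> + \<eta> * norm v" .
  \<comment> \<open>\<open>\<Delta>\<close> takes the increments of
    \<open>F t - t *\<^sub>R v\<close>, so its sum over the division telescopes.\<close>
  have "F b - F a - (b - a) *\<^sub>R v = (\<Sum>(t, k)\<in>q. \<Delta> k)"
    using additive_tagged_division_1[OF \<open>a \<le> b\<close> q(1), of "\<lambda>t. F t - t *\<^sub>R v"]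
    by (simp add: \<Delta>_def algebra_simps)
  also have "norm \<dots> \<le> (\<Sum>(t, k)\<in>q. norm (\<Delta> k))"
    by (simp add: case_prod_unfold sum_norm_le)
  also have "\<dots> = (\<Sum>(t, k)\<in>q - B. norm (\<Delta> k)) + (\<Sum>(t, k)\<in>B. norm (\<Delta> k))"
    using sum.subset_diff[OF \<open>B \<subseteq> q\<close> \<open>finite q\<close>] by blast
  also have "\<dots> \<le> c * (b - a) + e"
    using good_sum bad_sum \<eta> by (simp add: algebra_simps)
  finally show "norm (F b - F a - (b - a) *\<^sub>R v) \<le> c * (b - a) + e" .
qed

section \<open>Differentiability of trajectories where the control is continuous\<close>

lemma abs_continuous_on_imp_continuous_on:
  fixes F :: "real \<Rightarrow> 'a::real_normed_vector"
  assumes F: "abs_continuous_on {a..b} F"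
  shows "continuous_on {a..b} F"
proof (unfold continuous_on_iff, intro ballI allI impI)
  fix s e :: real assume s: "s \<in> {a..b}" and "e > 0"
  obtain \<delta> where "\<delta> > 0" and \<delta>: "\<And>d. \<lbrakk>d division_of \<Union>d; \<Union>d \<subseteq> {a..b}; (\<Sum>k\<in>d. Sup k - Inf k) < \<delta>\<rbrakk>
      \<Longrightarrow> (\<Sum>k\<in>d. norm (F (Sup k) - F (Inf k))) < e"
    using F \<open>e > 0\<close> unfolding abs_continuous_on_def by meson
  have "dist (F t) (F s) < e" if t: "t \<in> {a..b}" "dist t s < \<delta>" for t
  proof -
    \<comment> \<open>Absolute continuity is tested on the division consisting of the single
      interval between \<open>s\<close> and \<open>t\<close>.\<close>
    have "{min s t..max s t} \<noteq> {}"
      by auto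
    then have "{{min s t..max s t}} division_of \<Union>{{min s t..max s t}}"
      using division_of_self[of "min s t" "max s t"] by (simp add: box_real)
    from \<delta>[OF this] have "norm (F (max s t) - F (min s t)) < e"
      using s t by (auto simp: dist_real_def)
    then show ?thesis
      by (cases "s \<le> t") (auto simp: dist_norm norm_minus_commute)
  qed
  with \<open>\<delta> > 0\<close> show "\<exists>d>0. \<forall>t\<in>{a..b}. dist t s < d \<longrightarrow> dist (F t) (F s) < e"
    by blast
qed

text \<open>The point \<open>T\<close> may itself belong to the exceptional null set. Near
  \<open>T\<close>, however, every available derivative \<open>w t\<close> is within
  \<open>e\<close> of \<open>w T\<close>, so the mean value estimate with \<open>v = w T\<close> and
  \<open>c = e\<close> bounds the increments of \<open>F\<close> on both sides of
  \<open>T\<close>.\<close>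

proposition abs_continuous_has_vector_derivative:
  fixes F :: "real \<Rightarrow> 'a::real_normed_vector"
  assumes F: "\<And>a b. {a..b} \<subseteq> I \<Longrightarrow> abs_continuous_on {a..b} F"
    and der: "AE t in lebesgue_on I. (F has_vector_derivative w t) (at t within I)"
    and I: "I \<in> sets lebesgue" "T \<in> interior I" and w: "isCont w T"
  shows "(F has_vector_derivative w T) (at T)"
proof -
  have "AE t in lebesgue. t \<in> I \<longrightarrow> (F has_vector_derivative w t) (at t within I)"
    using der I(1) by (simp add: AE_restrict_space_iff)
  then obtain N where "negligible N"
    and N: "\<And>t. t \<in> I - N \<Longrightarrow> (F has_vector_derivative w t) (at t within I)"
    unfolding eventually_ae_filter_negligible by blast
  obtain r where "r > 0" and r: "ball T r \<subseteq> I"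
    using I(2) by (meson mem_interior)
  show ?thesis
    unfolding has_vector_derivative_def has_derivative_at_alt
  proof (intro conjI allI impI bounded_linear_scaleR_left)
    fix e :: real assume "e > 0"
    then obtain s where "s > 0" and s: "\<And>t. dist t T < s \<Longrightarrow> dist (w t) (w T) < e"
      using w unfolding continuous_at_eps_delta by blast
    have mean: "norm (F b - F a - (b - a) *\<^sub>R w T) \<le> e * (b - a)"
      if ab: "a \<le> b" "{a..b} \<subseteq> ball T (min r s)" for a b
    proof (rule abs_continuous_mean_value[OF ab(1) _ _ \<open>negligible N\<close>])
      have sub: "{a..b} \<subseteq> I"
        using ab(2) r by (auto simp: subset_iff)
      then show "abs_continuous_on {a..b} F"
        by (rule F)
      fix t assume t: "t \<in> {a..b} - N"
      then have "(F has_vector_derivative w t) (at t within {a..b})"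
        using N[of t] sub by (meson DiffD1 DiffD2 DiffI has_vector_derivative_within_subset subsetD)
      moreover have "norm (w t - w T) \<le> e"
        using s[of t] t ab(2) by (force simp: dist_norm norm_minus_commute)
      ultimately show "\<exists>D. (F has_vector_derivative D) (at t within {a..b}) \<and> norm (D - w T) \<le> e"
        by blast
    qed (use \<open>e > 0\<close> in simp)
    have "norm (F y - F T - (y - T) *\<^sub>R w T) \<le> e * norm (y - T)" if y: "norm (y - T) < min r s" for y
    proof (cases "T \<le> y")
      case True
      then have "{T..y} \<subseteq> ball T (min r s)"
        using y by (auto simp: dist_real_def)
      with mean[OF True] True show ?thesis
        by simp
    next
      case False
      then have "{y..T} \<subseteq> ball T (min r s)"
        using y by (auto simp: dist_real_def)
      moreover have "F y - F T - (y - T) *\<^sub>R w T = - (F T - F y - (T - y) *\<^sub>R w T)"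
        by (simp add: algebra_simps)
      then have "norm (F y - F T - (y - T) *\<^sub>R w T) = norm (F T - F y - (T - y) *\<^sub>R w T)"
        by (simp only: norm_minus_cancel)
      ultimately show ?thesis
        using mean[of y T] False by simp
    qed
    then show "\<exists>d>0. \<forall>y. norm (y - T) < d \<longrightarrow> norm (F y - F T - (y - T) *\<^sub>R w T) \<le> e * norm (y - T)"
      using \<open>r > 0\<close> \<open>s > 0\<close> by (intro exI[of _ "min r s"]) auto
  qed
qed

lemma isCont_matrix_vector_mult:
  fixes A :: "'b::t2_space \<Rightarrow> real^'m^'n" and u :: "'b \<Rightarrow> real^'m"
  assumes "isCont A t" "isCont u t"
  shows "isCont (\<lambda>t. A t *v u t) t"
  using assms unfolding isCont_def matrix_vector_mult_def
  by (intro tendsto_intros)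

lemma lipschitz_with_lipschitz_jacobian_isCont:
  "lipschitz_with_lipschitz_jacobian F \<Longrightarrow> isCont F y"
  unfolding lipschitz_with_lipschitz_jacobian_def by (meson has_derivative_continuous)

text \<open>The right-hand side is evaluated along \<open>x\<close> itself. Absolute continuity
  first makes \<open>x\<close> continuous at \<open>T\<close>; together with continuity of the
  control this makes the right-hand side continuous at \<open>T\<close>, as the preceding
  proposition requires.\<close>

proposition trajectory_has_vector_derivative:
  assumes traj: "trajectory f g u I x" and I: "I \<in> sets lebesgue" "T \<in> interior I"
    and u: "isCont u T" and f: "isCont f (x T)" and g: "isCont g (x T)"
  shows "(x has_vector_derivative f (x T) + g (x T) *v u T) (at T)"
proof -
  obtain e where "e > 0" and e: "cball T e \<subseteq> I"
    using I(2) by (meson mem_interior_cball)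
  then have "continuous_on {T - e..T + e} x"
    using traj by (intro abs_continuous_on_imp_continuous_on) (auto simp: trajectory_def cball_eq_atLeastAtMost)
  then have x: "isCont x T"
    using \<open>e > 0\<close> by (auto simp: continuous_on_interior)
  have "isCont (\<lambda>t. f (x t) + g (x t) *v u t) T"
    using x f g u by (intro continuous_add isCont_matrix_vector_mult isCont_o2[OF x])
  then show ?thesis
    using traj I abs_continuous_has_vector_derivative[of I x "\<lambda>t. f (x t) + g (x t) *v u t" T]
    by (auto simp: trajectory_def)
qed

section \<open>One-variable derivatives and tangent spaces in a flattening chart\<close>

text \<open>Positive values occur just after \<open>T\<close> if \<open>m > 0\<close> and just
  before \<open>T\<close> if \<open>m < 0\<close>. Both cases arise for a curve crossing a
  hyperplane, which is why \<open>P\<close> is assumed on both sides of \<open>T\<close>.\<close>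

lemma nonzero_derivative_imp_positive_value:
  fixes \<phi> :: "real \<Rightarrow> real"
  assumes \<phi>: "(\<phi> has_real_derivative m) (at T)" "\<phi> T = 0" and "m \<noteq> 0"
    and P: "eventually P (nhds T)"
  obtains t where "P t" "\<phi> t > 0"
proof -
  obtain d where "d > 0" and d: "\<And>t. \<bar>t - T\<bar> < d \<Longrightarrow> P t"
    using P by (auto simp: eventually_nhds_metric dist_real_def)
  show thesis
  proof (cases "m > 0")
    case True
    then obtain s where "s > 0" and s: "\<And>k. \<lbrakk>0 < k; k < s\<rbrakk> \<Longrightarrow> \<phi> T < \<phi> (T + k)"
      using DERIV_pos_inc_right[OF \<phi>(1)] by blast
    show thesis
      using that[of "T + min d s / 2"] d[of "T + min d s / 2"] s[of "min d s / 2"] \<phi>(2) \<open>d > 0\<close> \<open>s > 0\<close>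
      by (auto simp: min_def split: if_splits)
  next
    case False
    then obtain s where "s > 0" and s: "\<And>k. \<lbrakk>0 < k; k < s\<rbrakk> \<Longrightarrow> \<phi> T < \<phi> (T - k)"
      using DERIV_neg_dec_left[OF \<phi>(1)] \<open>m \<noteq> 0\<close> by (meson linorder_neqE)
    show thesis
      using that[of "T - min d s / 2"] d[of "T - min d s / 2"] s[of "min d s / 2"] \<phi>(2) \<open>d > 0\<close> \<open>s > 0\<close>
      by (auto simp: min_def split: if_splits)
  qed
qed

lemma has_vector_derivative_imp_quotient_tendsto:
  fixes F :: "real \<Rightarrow> 'a::real_normed_vector"
  assumes "(F has_vector_derivative v) (at 0)"
  shows "((\<lambda>t. (F t - F 0) /\<^sub>R t) \<longlongrightarrow> v) (at 0)"
proof -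
  have "((\<lambda>t. norm (F (0 + t) - F 0 - t *\<^sub>R v) / norm t) \<longlongrightarrow> 0) (at 0)"
    using assms unfolding has_vector_derivative_def has_derivative_at by blast
  moreover have "eventually (\<lambda>t. norm (F (0 + t) - F 0 - t *\<^sub>R v) / norm t = norm ((F t - F 0) /\<^sub>R t - v)) (at 0)"
  proof (rule eventually_mono[OF eventually_neq_at_within[of 0 0 UNIV]])
    fix t :: real assume "t \<noteq> 0"
    then have "(F t - F 0) /\<^sub>R t - v = (F (0 + t) - F 0 - t *\<^sub>R v) /\<^sub>R t"
      by (simp add: scaleR_diff_right)
    then show "norm (F (0 + t) - F 0 - t *\<^sub>R v) / norm t = norm ((F t - F 0) /\<^sub>R t - v)"
      by (simp add: divide_inverse mult.commute)
  qed
  ultimately have "((\<lambda>t. norm ((F t - F 0) /\<^sub>R t - v)) \<longlongrightarrow> 0) (at 0)"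
    by (rule Lim_transform_eventually)
  then show ?thesis
    by (rule LIM_zero_cancel[OF tendsto_norm_zero_cancel])
qed

text \<open>Unpacks the witnesses of \<open>C1_submanifold_at\<close>, with the derivatives named.
  Continuity of \<open>\<Psi>'\<close> makes the \<open>\<Psi>\<close>-images of straight lines
  \<open>C1\<close> curves.\<close>

locale C1_chart =
  fixes M W V L :: "'a::euclidean_space set" and \<Phi> \<Psi> :: "'a \<Rightarrow> 'a"
    and \<Phi>' \<Psi>' :: "'a \<Rightarrow> 'a \<Rightarrow>\<^sub>L 'a" and x :: 'a
  assumes W: "open W" and V: "open V" and homeo: "homeomorphism W V \<Phi> \<Psi>" and L: "subspace L"
    and flat: "\<Phi> ` (M \<inter> W) = L \<inter> V" and x: "x \<in> M" "x \<in> W"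
    and der_\<Phi>: "\<And>y. y \<in> W \<Longrightarrow> (\<Phi> has_derivative \<Phi>' y) (at y)"
    and der_\<Psi>: "\<And>y. y \<in> V \<Longrightarrow> (\<Psi> has_derivative \<Psi>' y) (at y)"
    and cont_\<Psi>': "continuous_on V \<Psi>'"
begin

lemma \<Psi>\<Phi>: "y \<in> W \<Longrightarrow> \<Psi> (\<Phi> y) = y" and \<Phi>\<Psi>: "z \<in> V \<Longrightarrow> \<Phi> (\<Psi> z) = z"
  and \<Phi>_mem: "y \<in> W \<Longrightarrow> \<Phi> y \<in> V" and \<Psi>_mem: "z \<in> V \<Longrightarrow> \<Psi> z \<in> W"
  using homeo by (auto simp: homeomorphism_def)

lemma \<Phi>_mem_L: "y \<in> M \<Longrightarrow> y \<in> W \<Longrightarrow> \<Phi> y \<in> L"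
  using flat by blast

lemma \<Psi>_mem_M: "z \<in> L \<Longrightarrow> z \<in> V \<Longrightarrow> \<Psi> z \<in> M"
proof -
  assume "z \<in> L" "z \<in> V"
  with flat obtain y where "y \<in> M" "y \<in> W" "z = \<Phi> y"
    by blast
  then show ?thesis
    by (simp add: \<Psi>\<Phi>)
qed

text \<open>Chain rule for \<open>\<Psi>\<close> after \<open>\<Phi>\<close>, which is the identity
  on the open set \<open>W\<close> around \<open>x\<close>.\<close>

lemma \<Psi>'\<Phi>': "\<Psi>' (\<Phi> x) (\<Phi>' x v) = v"
proof -
  have "((\<lambda>y. \<Psi> (\<Phi> y)) has_derivative (\<lambda>v. \<Psi>' (\<Phi> x) (\<Phi>' x v))) (at x)"
    using has_derivative_compose[OF der_\<Phi> der_\<Psi>] x \<Phi>_mem by blast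
  then have "((\<lambda>y. y) has_derivative (\<lambda>v. \<Psi>' (\<Phi> x) (\<Phi>' x v))) (at x)"
    by (rule has_derivative_transform_within_open[OF _ W x(2)]) (simp add: \<Psi>\<Phi>)
  from has_derivative_unique[OF this has_derivative_ident] show ?thesis
    by metis
qed

text \<open>A curve in \<open>M\<close> is mapped by \<open>\<Phi>\<close> into \<open>L\<close>;
  its difference quotients lie in \<open>L\<close>, which is closed, and so does their limit.
  Conversely, a direction in \<open>L\<close> spans a line through \<open>\<Phi> x\<close> inside
  \<open>L\<close>, and \<open>\<Psi>\<close> carries a short piece of it to a curve in
  \<open>M\<close>.\<close>

lemma tangent_space_eq: "tangent_space M x = {v. \<Phi>' x v \<in> L}"
proof (intro equalityI subsetI)
  fix v assume "v \<in> tangent_space M x"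
  then obtain \<delta> \<gamma> where "\<delta> > 0" and \<gamma>: "\<gamma> ` {-\<delta><..<\<delta>} \<subseteq> M" "\<gamma> 0 = x"
    "(\<gamma> has_vector_derivative v) (at 0)"
    by (auto simp: tangent_space_def)
  have "((\<Phi> \<circ> \<gamma>) has_vector_derivative \<Phi>' x v) (at 0)"
    using vector_derivative_diff_chain_within[OF \<gamma>(3), of \<Phi> "\<Phi>' x"] der_\<Phi>[OF x(2)] \<gamma>(2)
    by (auto intro: has_derivative_at_withinI)
  then have lim: "((\<lambda>t. (\<Phi> (\<gamma> t) - \<Phi> x) /\<^sub>R t) \<longlongrightarrow> \<Phi>' x v) (at 0)"
    using has_vector_derivative_imp_quotient_tendsto[of "\<Phi> \<circ> \<gamma>"] \<gamma>(2) by simp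
  have "isCont \<gamma> 0"
    using \<gamma>(3) has_vector_derivative_continuous by blast
  then have "eventually (\<lambda>t. \<gamma> t \<in> W) (at 0)"
    using W x(2) \<gamma>(2) by (auto simp: isCont_def intro: topological_tendstoD)
  moreover have "eventually (\<lambda>t. t \<in> {-\<delta><..<\<delta>}) (at 0)"
    using \<open>\<delta> > 0\<close> by (intro eventually_at_in_open') auto
  ultimately have "eventually (\<lambda>t. (\<Phi> (\<gamma> t) - \<Phi> x) /\<^sub>R t \<in> L) (at 0)"
  proof eventually_elim
    case (elim t)
    then show ?case
      using \<gamma>(1) x by (intro subspace_scale[OF L] subspace_diff[OF L] \<Phi>_mem_L) auto
  qed
  then show "v \<in> {v. \<Phi>' x v \<in> L}"
    using Lim_in_closed_set[OF closed_subspace[OF L] _ _ lim] by simp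
next
  fix v assume "v \<in> {v. \<Phi>' x v \<in> L}"
  define w where "w = \<Phi>' x v"
  define \<gamma> where "\<gamma> t = \<Psi> (\<Phi> x + t *\<^sub>R w)" for t
  have "w \<in> L" "\<Psi>' (\<Phi> x) w = v"
    using \<open>v \<in> _\<close> \<Psi>'\<Phi>' by (auto simp: w_def)
  have "open ((\<lambda>t. \<Phi> x + t *\<^sub>R w) -` V)"
    using V by (intro open_vimage continuous_intros)
  moreover have "0 \<in> (\<lambda>t. \<Phi> x + t *\<^sub>R w) -` V"
    using \<Phi>_mem x by simp
  ultimately obtain \<delta> where "\<delta> > 0" and \<delta>: "ball 0 \<delta> \<subseteq> (\<lambda>t. \<Phi> x + t *\<^sub>R w) -` V"
    by (meson openE)
  have inV: "\<Phi> x + t *\<^sub>R w \<in> V" if "t \<in> {-\<delta><..<\<delta>}" for t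
    using \<delta> that by (auto simp: subset_iff dist_real_def)
  have der: "(\<gamma> has_vector_derivative \<Psi>' (\<Phi> x + t *\<^sub>R w) w) (at t)" if t: "t \<in> {-\<delta><..<\<delta>}" for t
  proof -
    have "((\<lambda>t. \<Phi> x + t *\<^sub>R w) has_vector_derivative w) (at t)"
      by (auto intro!: derivative_eq_intros)
    from vector_derivative_diff_chain_within[OF this has_derivative_at_withinI[OF der_\<Psi>[OF inV[OF t]]]]
    show ?thesis
      by (simp add: o_def \<gamma>_def[abs_def])
  qed
  have "continuous_on {-\<delta><..<\<delta>} (\<lambda>t. \<Psi>' (\<Phi> x + t *\<^sub>R w) w)"
    using inV by (intro continuous_intros continuous_on_compose2[OF cont_\<Psi>']) auto
  then have "\<gamma> C1_differentiable_on {-\<delta><..<\<delta>}"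
    unfolding C1_differentiable_on_def
    by (intro exI[of _ "\<lambda>t. \<Psi>' (\<Phi> x + t *\<^sub>R w) w"] conjI ballI der)
  moreover have "\<Phi> x + t *\<^sub>R w \<in> L" for t
    using L \<Phi>_mem_L[OF x] \<open>w \<in> L\<close> by (simp add: subspace_add subspace_scale)
  then have "\<gamma> ` {-\<delta><..<\<delta>} \<subseteq> M"
    using \<Psi>_mem_M inV by (auto simp: \<gamma>_def)
  moreover have "\<gamma> 0 = x"
    using \<Psi>\<Phi> x by (simp add: \<gamma>_def)
  moreover have "(\<gamma> has_vector_derivative v) (at 0)"
    using der[of 0] \<open>\<delta> > 0\<close> \<open>\<Psi>' (\<Phi> x) w = v\<close> by simp
  ultimately show "v \<in> tangent_space M x"
    using \<open>\<delta> > 0\<close> unfolding tangent_space_def by blast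
qed

text \<open>The notion of submanifold leaves the dimension of \<open>L\<close> free. The derivative
  of \<open>\<Psi>\<close> maps \<open>L\<close> onto a set containing the tangent space, so
  \<open>dim L\<close> is at least \<open>DIM('a) - 1\<close>; the non-tangent vector
  \<open>v\<close> excludes \<open>L = UNIV\<close>.\<close>

lemma flat_hyperplane:
  assumes dim: "dim (tangent_space M x) = DIM('a) - 1" and v: "v \<notin> tangent_space M x"
  obtains a where "L = {y. a \<bullet> y = 0}"
proof -
  have "v \<in> \<Psi>' (\<Phi> x) ` L" if "\<Phi>' x v \<in> L" for v
    using imageI[OF that, of "\<Psi>' (\<Phi> x)"] by (simp only: \<Psi>'\<Phi>')
  then have "tangent_space M x \<subseteq> \<Psi>' (\<Phi> x) ` L"
    by (auto simp: tangent_space_eq)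
  then have "dim (tangent_space M x) \<le> dim (\<Psi>' (\<Phi> x) ` L)"
    by (rule dim_subset)
  also have "\<dots> \<le> dim L"
    by (intro dim_image_le bounded_linear.linear blinfun.bounded_linear_right)
  finally have "DIM('a) - 1 \<le> dim L"
    using dim by simp
  moreover have "L \<noteq> UNIV"
    using v by (auto simp: tangent_space_eq)
  then have "dim L \<noteq> DIM('a)"
    using L by (metis dim_eq_full span_eq_iff)
  moreover have "dim L \<le> DIM('a)"
    by (rule dim_subset_UNIV)
  ultimately have "dim L = DIM('a) - 1"
    by linarith
  with that L show thesis
    using lowdim_eq_hyperplane by (metis span_eq_iff)
qed

end

section \<open>Curves transversal to the frontier\<close>

text \<open>
  In the chart, the frontier is a hyperplane near \<open>x\<close>. Each open half ball is connected and avoids the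
  hyperplane, so it lies in \<open>S\<close> as soon as it contains a point of \<open>S\<close>, and \<open>\<gamma>\<close> enters both half balls.
\<close>

proposition transversal_curve_leaves:
  fixes S :: "'a::euclidean_space set"
  assumes "closed S" and M: "C1_submanifold_at (frontier S) x"
    and dim: "dim (tangent_space (frontier S) x) = DIM('a) - 1"
    and \<gamma>: "(\<gamma> has_vector_derivative v) (at T)" "\<gamma> T = x" and v: "v \<notin> tangent_space (frontier S) x"
  shows "\<not> eventually (\<lambda>t. \<gamma> t \<in> S) (nhds T)"
proof
  assume stays: "eventually (\<lambda>t. \<gamma> t \<in> S) (nhds T)"
  obtain W V \<Phi> \<Psi> L \<Phi>' \<Psi>' where "C1_chart (frontier S) W V L \<Phi> \<Psi> \<Phi>' \<Psi>' x"
    using M unfolding C1_submanifold_at_def C1_map_on_def C1_chart_def by metis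
  then interpret C1_chart "frontier S" W V L \<Phi> \<Psi> \<Phi>' \<Psi>' x .
  obtain a where L_eq: "L = {y. a \<bullet> y = 0}"
    using flat_hyperplane[OF dim v] by blast
  have "frontier S \<subseteq> S"
    using \<open>closed S\<close> by (simp add: frontier_subset_closed)
  obtain \<rho> where "\<rho> > 0" and \<rho>: "ball (\<Phi> x) \<rho> \<subseteq> V"
    using V \<Phi>_mem[OF x(2)] by (meson openE)
  have der: "((\<Phi> \<circ> \<gamma>) has_vector_derivative \<Phi>' x v) (at T)"
    using vector_derivative_diff_chain_within[OF \<gamma>(1), of \<Phi> "\<Phi>' x"] der_\<Phi>[OF x(2)] \<gamma>(2)
    by (auto intro: has_derivative_at_withinI)
  have "isCont \<gamma> T" "isCont (\<Phi> \<circ> \<gamma>) T"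
    using \<gamma>(1) der has_vector_derivative_continuous by blast+
  then have "eventually (\<lambda>t. \<gamma> t \<in> W) (nhds T)" "eventually (\<lambda>t. (\<Phi> \<circ> \<gamma>) t \<in> ball (\<Phi> x) \<rho>) (nhds T)"
    using W x(2) \<gamma>(2) \<open>\<rho> > 0\<close> topological_tendstoD[of \<gamma> x "nhds T" W]
      topological_tendstoD[of "\<Phi> \<circ> \<gamma>" "\<Phi> x" "nhds T" "ball (\<Phi> x) \<rho>"]
    unfolding isCont_def tendsto_at_iff_tendsto_nhds by auto
  then have near: "eventually (\<lambda>t. \<gamma> t \<in> S \<and> \<gamma> t \<in> W \<and> \<Phi> (\<gamma> t) \<in> ball (\<Phi> x) \<rho>) (nhds T)"
    using stays by eventually_elim auto
  \<comment> \<open>Allowing any normal \<open>b\<close> of \<open>L\<close> lets one argument serve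
    both half balls, with \<open>a\<close> and with \<open>- a\<close>.\<close>
  have side: "\<Psi> ` (ball (\<Phi> x) \<rho> \<inter> {y. b \<bullet> y > 0}) \<subseteq> S" if Lb: "L = {y. b \<bullet> y = 0}" for b
  proof -
    let ?H = "ball (\<Phi> x) \<rho> \<inter> {y. b \<bullet> y > 0}"
    have "((\<lambda>t. b \<bullet> \<Phi> (\<gamma> t)) has_real_derivative b \<bullet> \<Phi>' x v) (at T)"
      using bounded_linear.has_vector_derivative[OF bounded_linear_inner_right der, of b]
      by (simp add: has_real_derivative_iff_has_vector_derivative)
    moreover have "b \<bullet> \<Phi> (\<gamma> T) = 0"
      using \<Phi>_mem_L[OF x] \<gamma>(2) Lb by simp
    moreover have "b \<bullet> \<Phi>' x v \<noteq> 0"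
      using v Lb by (simp add: tangent_space_eq)
    ultimately obtain t where t: "\<gamma> t \<in> S" "\<gamma> t \<in> W" "\<Phi> (\<gamma> t) \<in> ?H"
      using nonzero_derivative_imp_positive_value[OF _ _ _ near] by blast
    have "connected ?H"
      by (intro convex_connected convex_Int convex_ball convex_halfspace_gt)
    then have "connected (\<Psi> ` ?H)"
      using \<rho> homeo
      by (intro connected_continuous_image) (auto simp: homeomorphism_def elim: continuous_on_subset)
    \<comment> \<open>A frontier point in \<open>W\<close> has its \<open>\<Phi>\<close>-image in
      \<open>L\<close>, where \<open>b \<bullet> y = 0\<close>.\<close>
    moreover have "\<Psi> ` ?H \<inter> frontier S = {}"
    proof -
      have "y \<in> L" if "y \<in> ball (\<Phi> x) \<rho>" "\<Psi> y \<in> frontier S" for y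
        using that \<rho> \<Phi>_mem_L[of "\<Psi> y"] \<Psi>_mem[of y] \<Phi>\<Psi>[of y] by auto
      then show ?thesis
        using Lb by fastforce
    qed
    moreover have "\<gamma> t \<in> \<Psi> ` ?H \<inter> S"
      using t \<Psi>\<Phi> by (metis IntI imageI)
    ultimately show ?thesis
      using connected_Int_frontier[of "\<Psi> ` ?H" S] by blast
  qed
  have "\<Psi> y \<in> S" if y: "y \<in> ball (\<Phi> x) \<rho>" for y
  proof -
    consider "a \<bullet> y > 0" | "(- a) \<bullet> y > 0" | "y \<in> L"
      using L_eq by force
    then show ?thesis
    proof cases
      case 1
      with side[OF L_eq] y show ?thesis by blast
    next
      case 2
      moreover have "L = {y. (- a) \<bullet> y = 0}"
        using L_eq by simp
      ultimately show ?thesis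
        using side y by blast
    next
      \<comment> \<open>Points of the hyperplane come from the frontier, which is part of
        \<open>S\<close> because \<open>S\<close> is closed.\<close>
      case 3
      with y \<rho> \<Psi>_mem_M \<open>frontier S \<subseteq> S\<close> show ?thesis by blast
    qed
  qed
  \<comment> \<open>Both half balls and the hyperplane together fill the ball, whose preimage is an
    open neighbourhood of \<open>x\<close>.\<close>
  then have "W \<inter> \<Phi> -` ball (\<Phi> x) \<rho> \<subseteq> S"
    using \<Psi>\<Phi> by (metis IntE subsetI vimageE)
  moreover have "open (W \<inter> \<Phi> -` ball (\<Phi> x) \<rho>)"
    using homeo W by (intro continuous_open_preimage) (auto simp: homeomorphism_def)
  ultimately have "x \<in> interior S"
    using x(2) \<open>\<rho> > 0\<close> by (intro interiorI) auto
  with x(1) show False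
    by (simp add: frontier_def)
qed

section \<open>Extremals of the minimum-time problem\<close>

theorem lemma1:
  fixes f :: "real^'n \<Rightarrow> real^'n"
    and g :: "real^'n \<Rightarrow> real^'m^'n"
    and U :: "(real^'m) set"
    and h :: "real^'n \<Rightarrow> real"
    and x0 :: "real^'n"
    and T p0 :: real
    and x p :: "real \<Rightarrow> real^'n"
    and u :: "real \<Rightarrow> real^'m"
  assumes "lipschitz_with_lipschitz_jacobian f"
    and "lipschitz_with_lipschitz_jacobian g"
    and "C1_map_on h UNIV"
    and "x0 \<in> safe_set h"
    and "T > 0"
    and "extremal f g U (safe_set h) x0 T x p p0 u"
    and A1: "C1_submanifold_at (frontier (safe_set h)) (x T)"
            "dim (tangent_space (frontier (safe_set h)) (x T)) = CARD('n) - 1"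
    and A2: "\<forall>t\<in>{0..T}. x t \<in> safe_set h"
    and A3: "\<exists>\<epsilon>>0. \<exists>u' x'.
               smooth_control_extension U T \<epsilon> u u' \<and>
               trajectory f g u' {0..<T + \<epsilon>} x' \<and> (\<forall>t\<in>{0..T}. x' t = x t) \<and>
               (\<forall>t\<in>{0..<T + \<epsilon>}. x' t \<in> safe_set h)"
  shows "p0 = 0"
proof (rule ccontr)
  let ?S = "safe_set h" and ?v = "f (x T) + g (x T) *v u T"
  assume "p0 \<noteq> 0"
  with \<open>extremal f g U ?S x0 T x p p0 u\<close> have "p T \<bullet> ?v = 1"
    and perp: "\<forall>v \<in> tangent_space (frontier ?S) (x T). orthogonal (p T) v"
    by (auto simp: extremal_def)
  then have v: "?v \<notin> tangent_space (frontier ?S) (x T)"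
    by (auto simp: orthogonal_def)
  obtain \<epsilon> u' x' where "\<epsilon> > 0" and u': "isCont u' T" "u' T = u T"
    and x': "trajectory f g u' {0..<T + \<epsilon>} x'" "x' T = x T" "\<forall>t\<in>{0..<T + \<epsilon>}. x' t \<in> ?S"
    using A3 \<open>T > 0\<close> by (force simp: smooth_control_extension_def)
  \<comment> \<open>The interval reaches before \<open>T\<close> because \<open>T > 0\<close> and
    past \<open>T\<close> because \<open>\<epsilon> > 0\<close>, so the derivative at
    \<open>T\<close> is two-sided.\<close>
  have "T \<in> interior {0..<T + \<epsilon>}"
    using \<open>T > 0\<close> \<open>\<epsilon> > 0\<close> by (intro interiorI[of "{0<..<T + \<epsilon>}"]) auto
  then have "(x' has_vector_derivative ?v) (at T)"
    using trajectory_has_vector_derivative[OF x'(1) _ _ u'(1)] u'(2) x'(2) assms(1,2)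
    by (auto simp: lipschitz_with_lipschitz_jacobian_isCont)
  moreover have "closed ?S"
  proof -
    have "continuous_on UNIV h"
      using \<open>C1_map_on h UNIV\<close> unfolding C1_map_on_def
      by (meson continuous_at_imp_continuous_on has_derivative_continuous)
    then show ?thesis
      unfolding safe_set_def by (intro closed_Collect_le continuous_intros)
  qed
  ultimately have "\<not> eventually (\<lambda>t. x' t \<in> ?S) (nhds T)"
    using transversal_curve_leaves[where \<gamma> = x', OF _ A1(1) _ _ x'(2) v] A1(2) by simp
  moreover have "eventually (\<lambda>t. t \<in> {0<..<T + \<epsilon>}) (nhds T)"
    using \<open>T > 0\<close> \<open>\<epsilon> > 0\<close> by (intro eventually_nhds_in_open) auto
  then have "eventually (\<lambda>t. x' t \<in> ?S) (nhds T)"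
    by eventually_elim (use x'(3) in auto)
  ultimately show False by contradiction
qed

end
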